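(* Let $A\in\mathbb{R}^{n\times n}$ and $B\in\mathbb{R}^{n\times m}$ be such that the pair $(A,B)$ is stabilizable. Let $\mathcal{A}=[a_{ij}]\in\mathbb{R}^{N\times N}$ with $a_{ij}\ge 0$ and $a_{ii}=0$ for all $i,j\in\{1,\dots,N\}$, let $\mathcal{D}=\mathrm{diag}(d_1,\dots,d_N)$ with $d_i>0$, and let $\mathcal{M}=\mathcal{D}-\mathcal{A}$. Suppose that $$d_i>\frac{\sum_{j=1}^N (a_{ij}+a_{ji})}{2},\qquad i\in\{1,\dots,N\}.$$ Then there exists a matrix $F\in\mathbb{R}^{m\times n}$ such that the linear system $$\dot{\xi}=(\bar A-\bar B\,\bar{\mathcal M}\,\bar F)\,\xi$$ is stable, where $\bar A=I_N\otimes A$, $\bar B=I_N\otimes B$, $\bar F=I_N\otimes F$ and $\bar{\mathcal M}=\mathcal{M}\otimes I_m$.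
   Context: $\otimes$ denotes the Kronecker product and $I_k$ the $k\times k$ identity matrix. The system arises as the closed-loop error dynamics of $N$ identical agents $\dot x_i=Ax_i+Bu_i$, with state $\xi(t)\in\mathbb{R}^{nN}$. A linear system $\dot\xi=G\xi$ is called stable if $G$ is Hurwitz, i.e. all eigenvalues of $G$ have strictly negative real part. The pair $(A,B)$ is stabilizable if there is a matrix $K\in\mathbb{R}^{m\times n}$ such that $A-BK$ is Hurwitz. *)

theory Defs
  imports "Jordan_Normal_Form.Char_Poly" Complex_Main
begin

definition kron :: "'a :: times mat \<Rightarrow> 'a mat \<Rightarrow> 'a mat" (infixl "\<otimes>\<^sub>m" 75) where
  "A \<otimes>\<^sub>m B = mat (dim_row A * dim_row B) (dim_col A * dim_col B)
     (\<lambda>(i, j). A $$ (i div dim_row B, j div dim_col B) * B $$ (i mod dim_row B, j mod dim_col B))"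

text \<open>The eigenvalues of a real matrix are those of its complexification.\<close>

definition hurwitz :: "real mat \<Rightarrow> bool" where
  "hurwitz G \<longleftrightarrow> square_mat G \<and>
     (\<forall>z. eigenvalue (map_mat complex_of_real G) z \<longrightarrow> Re z < 0)"

definition stabilizable :: "real mat \<Rightarrow> real mat \<Rightarrow> bool" where
  "stabilizable A B \<longleftrightarrow> (\<exists>K \<in> carrier_mat (dim_col B) (dim_col A). hurwitz (A - B * K))"

text \<open>A linear system is represented by the matrix \<open>G\<close> of the equation \<open>\<xi>' = G \<xi>\<close>.\<close>

definition stable_system :: "real mat \<Rightarrow> bool" where
  "stable_system G \<longleftrightarrow> hurwitz G"

lemma kron_carrier_mat [intro, simp]:
  assumes "A \<in> carrier_mat p q" and "B \<in> carrier_mat r s"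
  shows "A \<otimes>\<^sub>m B \<in> carrier_mat (p * r) (q * s)"
  using assms by (auto simp: kron_def)

end

(* Feed back F = (C / c) B^T P. Since A - B K is Hurwitz, it has a Lyapunov matrix P with
   x . P (A - B K) x <= - beta |x|^2, and Young's inequality absorbs the term g . K x, where
   g = B^T P x, into x . P A x <= C |g|^2 - (beta / 2) |x|^2. The degree condition says that the
   symmetric part of M is diagonally dominant, hence M + M^T >= 2 c I for some c > 0, so the
   coupling contributes at most - C (|g_1|^2 + ... + |g_N|^2), and I (x) P is a Lyapunov matrix
   for the closed loop. P comes from the complex Schur form T = V H V^(-1) as the real part of
   V^* W V with a diagonal weight W; taking real parts keeps the form on real vectors. *)

theory Submission imports Defs "Jordan_Normal_Form.Spectral_Radius"
begin

section \<open>Kronecker products and stacked vectors\<close>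

lemma sum_atLeast0_mult_split:
  "sum f {0..<N * n} = (\<Sum>i=0..<N. \<Sum>k=0..<n. f (i * n + k))" for f :: "nat \<Rightarrow> 'a :: comm_monoid_add"
proof -
  have "sum f {i * n..<i * n + n} = (\<Sum>k=0..<n. f (i * n + k))" for i
    using sum.shift_bounds_nat_ivl[of f 0 "i * n" n] by (simp add: add.commute)
  then show ?thesis using sum.nat_group[of f n N] by (simp add: lessThan_atLeast0)
qed

text \<open>Writing an index as block number times block size plus offset lets \<open>div\<close>
  and \<open>mod\<close> return the two parts, so later computations can work with pairs of
  indices.\<close>

lemma kron_index:
  assumes "A \<in> carrier_mat p q" "B \<in> carrier_mat r s" "i < p" "k < r" "j < q" "l < s"
  shows "(A \<otimes>\<^sub>m B) $$ (i * r + k, j * s + l) = A $$ (i, j) * B $$ (k, l)"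
proof -
  have lt: "a * c + b < d * c" if "a < d" "b < c" for a b c d :: nat
  proof -
    have "a * c + b < Suc a * c" using that by simp
    also have "\<dots> \<le> d * c" using that by (intro mult_le_mono1) simp
    finally show ?thesis .
  qed
  show ?thesis using assms lt[of i p k r] lt[of j q l s] by (simp add: kron_def)
qed

text \<open>The mixed-product rule. The inner sum over \<open>q * s\<close> splits into a double sum
  of products, which factors into one sum for each matrix product.\<close>

lemma kron_mult:
  fixes A B C D :: "'a :: comm_semiring_0 mat"
  assumes "A \<in> carrier_mat p q" "B \<in> carrier_mat r s" "C \<in> carrier_mat q u" "D \<in> carrier_mat s v"
  shows "(A \<otimes>\<^sub>m B) * (C \<otimes>\<^sub>m D) = (A * C) \<otimes>\<^sub>m (B * D)"
proof (rule eq_matI)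
  fix i j assume "i < dim_row ((A * C) \<otimes>\<^sub>m (B * D))" "j < dim_col ((A * C) \<otimes>\<^sub>m (B * D))"
  then have ij: "i < p * r" "j < u * v" using assms by (auto simp: kron_def)
  then have r: "0 < r" and v: "0 < v" by (auto intro: gr0I)
  define a b c d where "a = i div r" "b = i mod r" "c = j div v" "d = j mod v"
  have i: "i = a * r + b" "a < p" "b < r" and j: "j = c * v + d" "c < u" "d < v"
    using ij r v by (auto simp: a_b_c_d_def less_mult_imp_div_less)
  have "((A \<otimes>\<^sub>m B) * (C \<otimes>\<^sub>m D)) $$ (i, j)
      = (\<Sum>k=0..<q * s. (A \<otimes>\<^sub>m B) $$ (i, k) * (C \<otimes>\<^sub>m D) $$ (k, j))"
    using ij carrier_matD[OF kron_carrier_mat[OF assms(1,2)]] carrier_matD[OF kron_carrier_mat[OF assms(3,4)]]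
    by (simp add: scalar_prod_def)
  also have "\<dots> = (\<Sum>k=0..<q. \<Sum>l=0..<s. (A $$ (a, k) * B $$ (b, l)) * (C $$ (k, c) * D $$ (l, d)))"
    unfolding sum_atLeast0_mult_split
    using i j by (auto intro!: sum.cong simp: kron_index[OF assms(1,2)] kron_index[OF assms(3,4)])
  also have "\<dots> = (\<Sum>k=0..<q. A $$ (a, k) * C $$ (k, c)) * (\<Sum>l=0..<s. B $$ (b, l) * D $$ (l, d))"
    by (simp add: sum_product mult_ac)
  also have "\<dots> = (A * C) $$ (a, c) * (B * D) $$ (b, d)"
    using i j assms by (auto simp: scalar_prod_def)
  also have "\<dots> = ((A * C) \<otimes>\<^sub>m (B * D)) $$ (i, j)"
    unfolding i j by (rule kron_index[symmetric]) (use i j assms in auto)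
  finally show "((A \<otimes>\<^sub>m B) * (C \<otimes>\<^sub>m D)) $$ (i, j) = \<dots>" .
qed (use assms in \<open>auto simp: kron_def\<close>)

text \<open>For the stacked state of the agents this is the state of agent \<open>i\<close>, counted
  from 0.\<close>

definition vec_block :: "nat \<Rightarrow> nat \<Rightarrow> 'a vec \<Rightarrow> 'a vec" where
  "vec_block n i x = vec n (\<lambda>k. x $ (i * n + k))"

lemma vec_block_carrier [simp]: "vec_block n i x \<in> carrier_vec n"
  by (simp add: vec_block_def)

text \<open>The bridge from the closed loop to the single agents: estimates on the stacked state
  become sums of estimates on its blocks, weighted by the entries of \<open>M\<close>.\<close>

lemma scalar_prod_kron_mult_vec:
  fixes x y :: "'a :: comm_semiring_0 vec"
  assumes "M \<in> carrier_mat N N'" "L \<in> carrier_mat n n'"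
    "x \<in> carrier_vec (N * n)" "y \<in> carrier_vec (N' * n')"
  shows "x \<bullet> ((M \<otimes>\<^sub>m L) *\<^sub>v y)
    = (\<Sum>i=0..<N. \<Sum>j=0..<N'. M $$ (i, j) * (vec_block n i x \<bullet> (L *\<^sub>v vec_block n' j y)))"
proof -
  note K = kron_carrier_mat[OF assms(1,2)]
  have "x \<bullet> ((M \<otimes>\<^sub>m L) *\<^sub>v y)
      = (\<Sum>a=0..<N * n. x $ a * (\<Sum>b=0..<N' * n'. (M \<otimes>\<^sub>m L) $$ (a, b) * y $ b))"
    using carrier_matD[OF K] assms(3,4) by (simp add: scalar_prod_def)
  also have "\<dots> = (\<Sum>i=0..<N. \<Sum>k=0..<n. x $ (i * n + k) *
      (\<Sum>j=0..<N'. \<Sum>l=0..<n'. (M $$ (i, j) * L $$ (k, l)) * y $ (j * n' + l)))"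
    unfolding sum_atLeast0_mult_split by (auto intro!: sum.cong simp: kron_index[OF assms(1,2)])
  also have "\<dots> = (\<Sum>i=0..<N. \<Sum>j=0..<N'. \<Sum>k=0..<n. x $ (i * n + k) *
      (\<Sum>l=0..<n'. (M $$ (i, j) * L $$ (k, l)) * y $ (j * n' + l)))"
    by (subst sum.swap[where A = "{0..<N'}"]) (simp add: sum_distrib_left)
  also have "\<dots> = (\<Sum>i=0..<N. \<Sum>j=0..<N'. M $$ (i, j) * (vec_block n i x \<bullet> (L *\<^sub>v vec_block n' j y)))"
    using assms by (auto simp: scalar_prod_def vec_block_def sum_distrib_left mult_ac intro!: sum.cong)
  finally show ?thesis .
qed

lemma vec_block_nonzero:
  fixes x :: "'a :: zero vec"
  assumes "x \<in> carrier_vec (N * n)" "x \<noteq> 0\<^sub>v (N * n)"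
  shows "\<exists>i<N. vec_block n i x \<noteq> 0\<^sub>v n"
proof -
  obtain a where a: "a < N * n" "x $ a \<noteq> 0"
    using assms by (metis carrier_vecD eq_vecI index_zero_vec(1) index_zero_vec(2))
  then have n: "0 < n" by (auto intro: gr0I)
  have "vec_block n (a div n) x $ (a mod n) = x $ a" using n by (simp add: vec_block_def)
  then have "vec_block n (a div n) x \<noteq> 0\<^sub>v n" using a n by (metis index_zero_vec(1) mod_less_divisor)
  then show ?thesis using a by (auto simp: less_mult_imp_div_less)
qed

section \<open>Scalar product and norm estimates\<close>

lemma scalar_prod_self_nonneg: "0 \<le> x \<bullet> x" for x :: "real vec"
  by (simp add: scalar_prod_def sum_nonneg)

lemma scalar_prod_self_pos:
  fixes x :: "real vec"
  assumes "x \<in> carrier_vec n" "x \<noteq> 0\<^sub>v n"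
  shows "0 < x \<bullet> x"
proof -
  obtain a where a: "a < n" "x $ a \<noteq> 0"
    using assms by (metis carrier_vecD eq_vecI index_zero_vec(1) index_zero_vec(2))
  have "0 < (\<Sum>i=0..<n. x $ i * x $ i)" by (rule sum_pos2[of _ a]) (use a in \<open>auto simp: zero_less_mult_iff\<close>)
  then show ?thesis using assms by (simp add: scalar_prod_def)
qed

text \<open>Young's inequality with a free parameter \<open>t\<close>, summed over the
  coordinates.\<close>

lemma scalar_prod_le:
  fixes x y :: "real vec"
  assumes "x \<in> carrier_vec n" "y \<in> carrier_vec n" "0 < t"
  shows "x \<bullet> y \<le> (x \<bullet> x) / (2 * t) + t / 2 * (y \<bullet> y)"
proof -
  have "a * b \<le> (a * a) / (2 * t) + t / 2 * (b * b)" for a b :: real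
  proof -
    have "0 \<le> (a - t * b)\<^sup>2 / (2 * t)" using assms by simp
    also have "\<dots> = (a * a) / (2 * t) + t / 2 * (b * b) - a * b"
      using assms by (simp add: field_simps power2_eq_square)
    finally show ?thesis by simp
  qed
  then have "(\<Sum>i=0..<n. x $ i * y $ i)
      \<le> (\<Sum>i=0..<n. (x $ i * x $ i) / (2 * t) + t / 2 * (y $ i * y $ i))"
    by (intro sum_mono)
  then show ?thesis using assms(1,2)
    by (simp only: scalar_prod_def carrier_vecD sum.distrib sum_divide_distrib sum_distrib_left)
qed

text \<open>Every coordinate of \<open>x\<close> is bounded by the Euclidean norm, so row
  \<open>i\<close> contributes at most the square of its absolute row sum \<open>c i\<close>. The
  general field serves both a complex change of basis and a real feedback matrix.\<close>

lemma mult_mat_vec_bound: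
  fixes K :: "'a :: real_normed_field mat"
  assumes K: "K \<in> carrier_mat m n"
  shows "\<exists>k>0. \<forall>x \<in> carrier_vec n.
    (\<Sum>i=0..<m. (norm ((K *\<^sub>v x) $ i))\<^sup>2) \<le> k * (\<Sum>j=0..<n. (norm (x $ j))\<^sup>2)"
proof -
  define c where "c i = (\<Sum>j=0..<n. norm (K $$ (i, j)))" for i
  \<comment> \<open>The summand 1 keeps \<open>k\<close> positive even if \<open>K\<close> is zero
    or has no rows.\<close>
  define k where "k = 1 + (\<Sum>i=0..<m. (c i)\<^sup>2)"
  have "0 < k" unfolding k_def by (intro add_pos_nonneg sum_nonneg) auto
  moreover have "(\<Sum>i=0..<m. (norm ((K *\<^sub>v x) $ i))\<^sup>2) \<le> k * (\<Sum>j=0..<n. (norm (x $ j))\<^sup>2)"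
    if x: "x \<in> carrier_vec n" for x
  proof -
    let ?S = "\<Sum>j=0..<n. (norm (x $ j))\<^sup>2"
    have S: "0 \<le> ?S" by (simp add: sum_nonneg)
    have xj: "norm (x $ j) \<le> sqrt ?S" if "j < n" for j
    proof (rule real_le_rsqrt)
      show "(norm (x $ j))\<^sup>2 \<le> ?S"
        using that by (intro member_le_sum[where f = "\<lambda>j. (norm (x $ j))\<^sup>2"]) auto
    qed
    have "(norm ((K *\<^sub>v x) $ i))\<^sup>2 \<le> (c i)\<^sup>2 * ?S" if i: "i < m" for i
    proof -
      have "norm ((K *\<^sub>v x) $ i) = norm (\<Sum>j=0..<n. K $$ (i, j) * x $ j)"
        using K x i by (simp add: scalar_prod_def)
      also have "\<dots> \<le> (\<Sum>j=0..<n. norm (K $$ (i, j)) * sqrt ?S)"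
        by (rule sum_norm_le) (auto simp: norm_mult intro!: mult_left_mono xj)
      also have "\<dots> = c i * sqrt ?S" by (simp add: c_def sum_distrib_right)
      finally have "(norm ((K *\<^sub>v x) $ i))\<^sup>2 \<le> (c i * sqrt ?S)\<^sup>2" by (intro power_mono) auto
      also have "\<dots> = (c i)\<^sup>2 * ?S" using S by (simp add: power_mult_distrib)
      finally show ?thesis .
    qed
    then have "(\<Sum>i=0..<m. (norm ((K *\<^sub>v x) $ i))\<^sup>2) \<le> (\<Sum>i=0..<m. (c i)\<^sup>2 * ?S)"
      by (intro sum_mono) auto
    also have "\<dots> \<le> k * ?S" using S by (simp add: k_def sum_distrib_right distrib_right)
    finally show ?thesis .
  qed
  ultimately show ?thesis by blast
qed

section \<open>A Lyapunov matrix for a Hurwitz matrix\<close>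

text \<open>The weights \<open>r\<^sup>2\<^sup>k\<close> amount to a diagonal change of basis; for large \<open>r\<close> it makes the entries
  above the diagonal negligible.\<close>

lemma upper_triangular_weighted_form:
  fixes T :: "complex mat"
  assumes T: "T \<in> carrier_mat n n" "upper_triangular T"
    and neg: "\<And>i. i < n \<Longrightarrow> Re (T $$ (i, i)) < 0"
  shows "\<exists>r\<ge>1. \<exists>b>0. \<forall>w \<in> carrier_vec n.
    (\<Sum>k=0..<n. r ^ (2 * k) * Re (cnj (w $ k) * (T *\<^sub>v w) $ k)) \<le> - b * (\<Sum>k=0..<n. (norm (w $ k))\<^sup>2)"
proof -
  \<comment> \<open>A uniform decay rate of the diagonal; inserting 1 makes the minimum meaningful
    for \<open>n = 0\<close>.\<close>
  define \<delta> where "\<delta> = Min (insert 1 ((\<lambda>i. - Re (T $$ (i, i))) ` {0..<n}))"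
  have \<delta>: "0 < \<delta>" using neg by (auto simp: \<delta>_def)
  have \<delta>_le: "Re (T $$ (i, i)) \<le> - \<delta>" if "i < n" for i
  proof -
    have "\<delta> \<le> - Re (T $$ (i, i))" unfolding \<delta>_def using that by (intro Min_le) auto
    then show ?thesis by simp
  qed
  define \<tau> where "\<tau> = (\<Sum>i=0..<n. \<Sum>j=0..<n. norm (T $$ (i, j)))"
  have \<tau>: "0 \<le> \<tau>" by (simp add: \<tau>_def sum_nonneg)
  have \<tau>_ge: "norm (T $$ (i, j)) \<le> \<tau>" if "i < n" "j < n" for i j
  proof -
    have "norm (T $$ (i, j)) \<le> (\<Sum>j=0..<n. norm (T $$ (i, j)))"
      using that by (intro member_le_sum[where f = "\<lambda>j. norm (T $$ (i, j))"]) auto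
    also have "\<dots> \<le> \<tau>" unfolding \<tau>_def
      using that by (intro member_le_sum[where f = "\<lambda>i. \<Sum>j=0..<n. norm (T $$ (i, j))"]) (auto simp: sum_nonneg)
    finally show ?thesis .
  qed
  \<comment> \<open>Chosen so that \<open>\<tau> * n / r \<le> \<delta> / 2\<close>: the
    off-diagonal entries together use up at most half of the diagonal decay.\<close>
  define r where "r = 1 + 2 * \<tau> * n / \<delta>"
  have r: "1 \<le> r" using \<tau> \<delta> by (simp add: r_def)
  have r': "\<tau> * n / r \<le> \<delta> / 2"
  proof -
    have "2 * \<tau> * n \<le> \<delta> * r" using \<delta> by (simp add: r_def field_simps)
    then show ?thesis using r by (simp add: field_simps)
  qed
  have "(\<Sum>k=0..<n. r ^ (2 * k) * Re (cnj (w $ k) * (T *\<^sub>v w) $ k)) \<le> - (\<delta> / 2) * (\<Sum>k=0..<n. (norm (w $ k))\<^sup>2)"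
    if w: "w \<in> carrier_vec n" for w
  proof -
    define a where "a k = r ^ k * norm (w $ k)" for k
    define S where "S = (\<Sum>k=0..<n. (a k)\<^sup>2)"
    \<comment> \<open>Diagonal entries supply the decay, entries above the diagonal cost a term of
      order \<open>1 / r\<close>, and entries below vanish. The nonnegative error term is charged to
      every pair, so that the double sum can be evaluated in closed form.\<close>
    have entry: "r ^ (2 * k) * Re (cnj (w $ k) * (T $$ (k, j) * w $ j))
        \<le> (if j = k then - \<delta> * (a k)\<^sup>2 else 0) + \<tau> / (2 * r) * ((a k)\<^sup>2 + (a j)\<^sup>2)"
      if kj: "k < n" "j < n" for k j
    proof -
      have nn: "0 \<le> \<tau> / (2 * r) * ((a k)\<^sup>2 + (a j)\<^sup>2)" using \<tau> r by simp
      consider "j < k" | "j = k" | "k < j" by linarith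
      then show ?thesis
      proof cases
        case 1
        then have "T $$ (k, j) = 0" using T kj by (auto simp: upper_triangular_def)
        then show ?thesis using 1 nn by simp
      next
        case 2
        have "Re (cnj (w $ k) * (T $$ (k, k) * w $ k)) = Re (T $$ (k, k)) * (norm (w $ k))\<^sup>2"
          unfolding cmod_power2 by (simp add: algebra_simps power2_eq_square)
        also have "\<dots> \<le> - \<delta> * (norm (w $ k))\<^sup>2" using \<delta>_le[OF kj(1)] by (intro mult_right_mono) auto
        finally have "r ^ (2 * k) * Re (cnj (w $ k) * (T $$ (k, k) * w $ k)) \<le> r ^ (2 * k) * (- \<delta> * (norm (w $ k))\<^sup>2)"
          using r by (intro mult_left_mono) auto
        also have "\<dots> = - \<delta> * (a k)\<^sup>2" by (simp add: a_def power_mult_distrib power_mult power2_eq_square mult_ac)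
        finally show ?thesis using 2 nn by simp
      next
        case 3
        have "Re (cnj (w $ k) * (T $$ (k, j) * w $ j)) \<le> norm (cnj (w $ k) * (T $$ (k, j) * w $ j))"
          by (rule complex_Re_le_cmod)
        also have "\<dots> \<le> \<tau> * (norm (w $ k) * norm (w $ j))"
          using mult_right_mono[OF \<tau>_ge[OF kj], of "norm (w $ k) * norm (w $ j)"]
          by (simp add: norm_mult mult_ac)
        \<comment> \<open>Above the diagonal \<open>j\<close> is at least \<open>k + 1\<close>, so
          \<open>r ^ (2 * k)\<close> lacks at least one factor \<open>r\<close> compared with
          \<open>r ^ (k + j)\<close>, the weight of \<open>a k * a j\<close>. This missing factor is
          the gain \<open>1 / r\<close>.\<close>
        finally have "r * (r ^ (2 * k) * Re (cnj (w $ k) * (T $$ (k, j) * w $ j)))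
            \<le> r * (r ^ (2 * k) * (\<tau> * (norm (w $ k) * norm (w $ j))))"
          using r by (intro mult_left_mono) auto
        also have "\<dots> = r ^ (k + Suc k) * (\<tau> * (norm (w $ k) * norm (w $ j)))"
          by (simp add: power_add mult_2 mult_2_right mult_ac)
        also have "\<dots> \<le> r ^ (k + j) * (\<tau> * (norm (w $ k) * norm (w $ j)))"
          using r 3 \<tau> by (intro mult_right_mono power_increasing) auto
        also have "\<dots> = \<tau> * (a k * a j)" by (simp add: a_def power_add mult_ac)
        also have "\<dots> \<le> \<tau> * (((a k)\<^sup>2 + (a j)\<^sup>2) / 2)"
          using \<tau> sum_squares_bound[of "a k" "a j"] by (intro mult_left_mono) auto
        finally show ?thesis using r 3 by (simp add: field_simps)
      qed
    qed
    have "(\<Sum>k=0..<n. r ^ (2 * k) * Re (cnj (w $ k) * (T *\<^sub>v w) $ k))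
        = (\<Sum>k=0..<n. \<Sum>j=0..<n. r ^ (2 * k) * Re (cnj (w $ k) * (T $$ (k, j) * w $ j)))"
      using T w by (auto simp: scalar_prod_def sum_distrib_left simp del: times_complex.sel intro!: sum.cong)
    also have "\<dots> \<le> (\<Sum>k=0..<n. \<Sum>j=0..<n. (if j = k then - \<delta> * (a k)\<^sup>2 else 0)
        + \<tau> / (2 * r) * ((a k)\<^sup>2 + (a j)\<^sup>2))"
      by (intro sum_mono entry) auto
    also have "\<dots> = - \<delta> * S + \<tau> / (2 * r) * (n * S + n * S)"
    proof -
      have "(\<Sum>k=0..<n. \<Sum>j=0..<n. (if j = k then - \<delta> * (a k)\<^sup>2 else 0)) = - \<delta> * S"
        by (simp add: S_def sum_distrib_left)
      moreover have "(\<Sum>k=0..<n. \<Sum>j=0..<n. \<tau> / (2 * r) * ((a k)\<^sup>2 + (a j)\<^sup>2))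
          = \<tau> / (2 * r) * (\<Sum>k=0..<n. n * (a k)\<^sup>2 + S)"
        by (simp only: sum_distrib_left[symmetric] sum.distrib sum_constant S_def) simp
      moreover have "(\<Sum>k=0..<n. n * (a k)\<^sup>2 + S) = n * S + n * S"
        by (simp only: sum.distrib sum_distrib_left[symmetric] sum_constant S_def) simp
      ultimately show ?thesis by (simp only: sum.distrib)
    qed
    also have "\<dots> = - \<delta> * S + \<tau> * n / r * S" by (simp add: field_simps)
    also have "\<dots> \<le> - \<delta> * S + \<delta> / 2 * S"
      using r' by (intro add_left_mono mult_right_mono) (auto simp: S_def sum_nonneg)
    also have "\<dots> = - (\<delta> / 2) * S" by (simp add: algebra_simps)
    \<comment> \<open>As \<open>r \<ge> 1\<close>, the weights only enlarge the norm, so a decay in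
      terms of \<open>S\<close> implies one in the plain norm.\<close>
    also have "\<dots> \<le> - (\<delta> / 2) * (\<Sum>k=0..<n. (norm (w $ k))\<^sup>2)"
    proof -
      have "(norm (w $ k))\<^sup>2 \<le> (a k)\<^sup>2" for k
        unfolding a_def using r by (intro power_mono) (auto simp: mult_le_cancel_right1)
      then have "(\<Sum>k=0..<n. (norm (w $ k))\<^sup>2) \<le> S" unfolding S_def by (intro sum_mono)
      then show ?thesis using \<delta> by (simp add: mult_left_mono)
    qed
    finally show ?thesis .
  qed
  then show ?thesis using r half_gt_zero[OF \<delta>]
    by (intro exI[of _ r] exI[of _ "\<delta> / 2"] conjI ballI)
qed

text \<open>In the coordinates \<open>w x\<close> the matrix \<open>H\<close> acts as the triangular
  \<open>T\<close>, for which the weighted estimate is available. The inverse change of basis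
  \<open>U\<close> converts the decay in \<open>w x\<close> back into a decay in
  \<open>x\<close>.\<close>

lemma hurwitz_lyapunov:
  assumes H: "H \<in> carrier_mat n n" and hw: "hurwitz H"
  shows "\<exists>P \<in> carrier_mat n n. \<exists>\<beta>>0.
    (\<forall>x \<in> carrier_vec n. \<forall>y \<in> carrier_vec n. x \<bullet> (P *\<^sub>v y) = y \<bullet> (P *\<^sub>v x)) \<and>
    (\<forall>x \<in> carrier_vec n. 0 \<le> x \<bullet> (P *\<^sub>v x)) \<and>
    (\<forall>x \<in> carrier_vec n. x \<bullet> (P *\<^sub>v (H *\<^sub>v x)) \<le> - \<beta> * (x \<bullet> x))"
proof -
  let ?c = complex_of_real
  define Hc where "Hc = map_mat ?c H"
  have Hc: "Hc \<in> carrier_mat n n" using H by (simp add: Hc_def)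
  obtain es where es: "char_poly Hc = (\<Prod>e \<leftarrow> es. [:- e, 1:])"
    using char_poly_factorized[OF Hc] by blast
  obtain T U V where TUV: "schur_decomposition Hc es = (T, U, V)" by (metis prod_cases3)
  note S = schur_decomposition[OF Hc es TUV]
  have cT: "T \<in> carrier_mat n n" and cU: "U \<in> carrier_mat n n" and cV: "V \<in> carrier_mat n n"
    and UV: "U * V = 1\<^sub>m n" and VU: "V * U = 1\<^sub>m n" and HTUV: "Hc = U * T * V"
    using S Hc by (auto simp: similar_mat_wit_def Let_def)
  \<comment> \<open>The Schur form carries the list \<open>es\<close> on its diagonal, and
    \<open>es\<close> consists of the roots of the characteristic polynomial, that is, of
    eigenvalues of \<open>Hc\<close>.\<close>
  have neg: "Re (T $$ (i, i)) < 0" if i: "i < n" for i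
  proof -
    have "T $$ (i, i) \<in> set es" using S cT i by (auto simp: diag_mat_def)
    then have "poly (char_poly Hc) (T $$ (i, i)) = 0"
      unfolding es by (auto simp: poly_prod_list prod_list_zero_iff)
    then have "eigenvalue Hc (T $$ (i, i))" by (simp add: eigenvalue_root_char_poly[OF Hc])
    then show ?thesis using hw by (simp add: hurwitz_def Hc_def)
  qed
  obtain r b where r: "1 \<le> r" and b: "0 < b" and form: "\<And>w. w \<in> carrier_vec n \<Longrightarrow>
      (\<Sum>k=0..<n. r ^ (2 * k) * Re (cnj (w $ k) * (T *\<^sub>v w) $ k)) \<le> - b * (\<Sum>k=0..<n. (norm (w $ k))\<^sup>2)"
    using upper_triangular_weighted_form[OF cT] S neg by blast
  obtain u where u: "0 < u" and ub: "\<And>w. w \<in> carrier_vec n \<Longrightarrow>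
      (\<Sum>i=0..<n. (norm ((U *\<^sub>v w) $ i))\<^sup>2) \<le> u * (\<Sum>j=0..<n. (norm (w $ j))\<^sup>2)"
    using mult_mat_vec_bound[OF cU] by blast
  \<comment> \<open>The diagonal weight \<open>W\<close> has the entries
    \<open>r ^ (2 * k)\<close>.\<close>
  define P where "P = mat n n (\<lambda>(i, j). \<Sum>k=0..<n. r ^ (2 * k) * Re (cnj (V $$ (k, i)) * V $$ (k, j)))"
  define w where "w x = V *\<^sub>v map_vec ?c x" for x
  have P: "P \<in> carrier_mat n n" by (simp add: P_def)
  have w_carrier: "w x \<in> carrier_vec n" if "x \<in> carrier_vec n" for x
    using that cV by (simp add: w_def)
  \<comment> \<open>For real \<open>x\<close> and \<open>y\<close> the factors
    \<open>x $ i * y $ j\<close> pass through \<open>Re\<close>, so the form of \<open>P\<close> is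
    the real part of the weighted Hermitian form in \<open>w x\<close> and
    \<open>w y\<close>.\<close>
  have form_P: "x \<bullet> (P *\<^sub>v y) = (\<Sum>k=0..<n. r ^ (2 * k) * Re (cnj (w x $ k) * w y $ k))"
    if x: "x \<in> carrier_vec n" and y: "y \<in> carrier_vec n" for x y
  proof -
    have wk: "w x $ k = (\<Sum>i=0..<n. V $$ (k, i) * ?c (x $ i))" if "x \<in> carrier_vec n" "k < n" for x k
      using that cV by (simp add: w_def scalar_prod_def)
    have "r ^ (2 * k) * Re (cnj (w x $ k) * w y $ k)
        = (\<Sum>i=0..<n. \<Sum>j=0..<n. x $ i * (r ^ (2 * k) * Re (cnj (V $$ (k, i)) * V $$ (k, j)) * y $ j))"
      if k: "k < n" for k
    proof -
      have "cnj (w x $ k) * w y $ k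
          = (\<Sum>i=0..<n. \<Sum>j=0..<n. ?c (x $ i * y $ j) * (cnj (V $$ (k, i)) * V $$ (k, j)))"
        unfolding wk[OF x k] wk[OF y k] cnj_sum sum_product by (simp add: mult_ac)
      also have "Re \<dots> = (\<Sum>i=0..<n. \<Sum>j=0..<n. x $ i * y $ j * Re (cnj (V $$ (k, i)) * V $$ (k, j)))"
        unfolding Re_sum by (simp add: algebra_simps)
      finally show ?thesis by (simp only: sum_distrib_left mult_ac)
    qed
    then have "(\<Sum>k=0..<n. r ^ (2 * k) * Re (cnj (w x $ k) * w y $ k))
        = (\<Sum>k=0..<n. \<Sum>i=0..<n. \<Sum>j=0..<n. x $ i * (r ^ (2 * k) * Re (cnj (V $$ (k, i)) * V $$ (k, j)) * y $ j))"
      by (intro sum.cong) auto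
    also have "\<dots> = (\<Sum>i=0..<n. \<Sum>k=0..<n. \<Sum>j=0..<n. x $ i * (r ^ (2 * k) * Re (cnj (V $$ (k, i)) * V $$ (k, j)) * y $ j))"
      by (rule sum.swap)
    also have "\<dots> = (\<Sum>i=0..<n. \<Sum>j=0..<n. \<Sum>k=0..<n. x $ i * (r ^ (2 * k) * Re (cnj (V $$ (k, i)) * V $$ (k, j)) * y $ j))"
      by (intro sum.cong refl sum.swap)
    also have "\<dots> = (\<Sum>i=0..<n. x $ i * (\<Sum>j=0..<n. P $$ (i, j) * y $ j))"
      by (simp add: P_def sum_distrib_left sum_distrib_right del: times_complex.sel)
    also have "\<dots> = x \<bullet> (P *\<^sub>v y)" using P x y by (simp add: scalar_prod_def)
    finally show ?thesis by simp
  qed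
  have sym: "x \<bullet> (P *\<^sub>v y) = y \<bullet> (P *\<^sub>v x)" if "x \<in> carrier_vec n" "y \<in> carrier_vec n" for x y
    unfolding form_P[OF that] form_P[OF that(2,1)] by (simp add: mult.commute)
  have nonneg: "0 \<le> x \<bullet> (P *\<^sub>v x)" if "x \<in> carrier_vec n" for x
    unfolding form_P[OF that that] using r by (auto intro!: sum_nonneg mult_nonneg_nonneg)
  have "x \<bullet> (P *\<^sub>v (H *\<^sub>v x)) \<le> - (b / u) * (x \<bullet> x)" if x: "x \<in> carrier_vec n" for x
  proof -
    have cx: "map_vec ?c x \<in> carrier_vec n" using x by simp
    have "map_vec ?c (H *\<^sub>v x) = Hc *\<^sub>v map_vec ?c x"
      unfolding Hc_def by (rule of_real_hom.mult_mat_vec_hom[OF H x])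
    then have "w (H *\<^sub>v x) = V *\<^sub>v (Hc *\<^sub>v map_vec ?c x)" by (simp add: w_def)
    also have "\<dots> = T *\<^sub>v w x"
    proof -
      have "V * Hc = T * V"
      proof -
        have "V * Hc = (V * U) * T * V"
          unfolding HTUV using cT cU cV by (simp add: assoc_mult_mat[of _ n n _ n _ n])
        then show ?thesis using cT by (simp add: VU)
      qed
      then show ?thesis unfolding w_def
        using assoc_mult_mat_vec[OF cV Hc cx] assoc_mult_mat_vec[OF cT cV cx] by simp
    qed
    finally have wH: "w (H *\<^sub>v x) = T *\<^sub>v w x" .
    \<comment> \<open>Since \<open>U\<close> inverts \<open>V\<close>, the bound \<open>u\<close>
      for \<open>U\<close> gives a lower bound of the norm of \<open>w x\<close> by that of
      \<open>x\<close>.\<close>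
    have "U *\<^sub>v w x = map_vec ?c x"
      unfolding w_def using assoc_mult_mat_vec[OF cU cV cx] cx by (simp add: UV)
    then have "(\<Sum>i=0..<n. (norm ((U *\<^sub>v w x) $ i))\<^sup>2) = x \<bullet> x"
      using x by (simp add: scalar_prod_def power2_eq_square)
    then have xx: "x \<bullet> x \<le> u * (\<Sum>j=0..<n. (norm (w x $ j))\<^sup>2)"
      using ub[OF w_carrier[OF x]] by simp
    have "x \<bullet> (P *\<^sub>v (H *\<^sub>v x)) \<le> - b * (\<Sum>j=0..<n. (norm (w x $ j))\<^sup>2)"
      using form[OF w_carrier[OF x]] form_P[of x "H *\<^sub>v x"] x H by (simp add: wH)
    also have "\<dots> \<le> - (b / u) * (x \<bullet> x)" using xx b u by (simp add: field_simps)
    finally show ?thesis .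
  qed
  moreover have "0 < b / u" using b u by simp
  ultimately show ?thesis using P sym nonneg by blast
qed

section \<open>Stability from a quadratic form\<close>

text \<open>For an eigenvector with real part \<open>x\<close> and imaginary part \<open>y\<close>,
  adding the forms at \<open>x\<close> and \<open>y\<close> gives \<open>Re z\<close> times a
  nonnegative number. The sum is negative, so \<open>Re z\<close> must be negative.\<close>

lemma hurwitzI_quadratic_form:
  fixes G P :: "real mat"
  assumes G: "G \<in> carrier_mat n n" and P: "P \<in> carrier_mat n n"
    and sym: "\<And>x y. x \<in> carrier_vec n \<Longrightarrow> y \<in> carrier_vec n \<Longrightarrow> x \<bullet> (P *\<^sub>v y) = y \<bullet> (P *\<^sub>v x)"
    and nonneg: "\<And>x. x \<in> carrier_vec n \<Longrightarrow> 0 \<le> x \<bullet> (P *\<^sub>v x)"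
    and neg: "\<And>x. x \<in> carrier_vec n \<Longrightarrow> x \<noteq> 0\<^sub>v n \<Longrightarrow> x \<bullet> (P *\<^sub>v (G *\<^sub>v x)) < 0"
  shows "hurwitz G"
  unfolding hurwitz_def
proof (intro conjI allI impI)
  show "square_mat G" using G by simp
  fix z assume "eigenvalue (map_mat complex_of_real G) z"
  then obtain v where v: "v \<in> carrier_vec n" "v \<noteq> 0\<^sub>v n" "map_mat complex_of_real G *\<^sub>v v = z \<cdot>\<^sub>v v"
    using G by (auto simp: eigenvalue_def eigenvector_def)
  define x where "x = map_vec Re v"
  define y where "y = map_vec Im v"
  have x: "x \<in> carrier_vec n" and y: "y \<in> carrier_vec n" using v by (auto simp: x_def y_def)
  have comp: "(\<Sum>j=0..<n. complex_of_real (G $$ (i, j)) * v $ j) = z * v $ i" if "i < n" for i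
  proof -
    have "(map_mat complex_of_real G *\<^sub>v v) $ i = (z \<cdot>\<^sub>v v) $ i" by (simp add: v)
    then show ?thesis using that G v(1) by (simp add: scalar_prod_def)
  qed
  \<comment> \<open>This equation and the next are the real and imaginary parts of the eigenvalue
    equation.\<close>
  have Gx: "G *\<^sub>v x = Re z \<cdot>\<^sub>v x + (- Im z) \<cdot>\<^sub>v y"
  proof (rule eq_vecI)
    fix i assume "i < dim_vec (Re z \<cdot>\<^sub>v x + (- Im z) \<cdot>\<^sub>v y)"
    then have i: "i < n" using y by simp
    then show "(G *\<^sub>v x) $ i = (Re z \<cdot>\<^sub>v x + (- Im z) \<cdot>\<^sub>v y) $ i"
      using arg_cong[OF comp[OF i], of Re] G v(1) by (simp add: scalar_prod_def x_def y_def)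
  qed (use G y in auto)
  have Gy: "G *\<^sub>v y = Im z \<cdot>\<^sub>v x + Re z \<cdot>\<^sub>v y"
  proof (rule eq_vecI)
    fix i assume "i < dim_vec (Im z \<cdot>\<^sub>v x + Re z \<cdot>\<^sub>v y)"
    then have i: "i < n" using y by simp
    then show "(G *\<^sub>v y) $ i = (Im z \<cdot>\<^sub>v x + Re z \<cdot>\<^sub>v y) $ i"
      using arg_cong[OF comp[OF i], of Im] G v(1) by (simp add: scalar_prod_def x_def y_def)
  qed (use G y in auto)
  have lin: "t \<bullet> (P *\<^sub>v (a \<cdot>\<^sub>v x + b \<cdot>\<^sub>v y)) = a * (t \<bullet> (P *\<^sub>v x)) + b * (t \<bullet> (P *\<^sub>v y))"
    if t: "t \<in> carrier_vec n" for t a b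
    using t x y P by (simp add: mult_add_distrib_mat_vec[OF P] mult_mat_vec[OF P] scalar_prod_add_distrib[OF t])
  \<comment> \<open>The cross terms with \<open>Im z\<close> have opposite signs and cancel by the
    symmetry of \<open>P\<close>.\<close>
  have eq: "x \<bullet> (P *\<^sub>v (G *\<^sub>v x)) + y \<bullet> (P *\<^sub>v (G *\<^sub>v y)) = Re z * (x \<bullet> (P *\<^sub>v x) + y \<bullet> (P *\<^sub>v y))"
    unfolding Gx Gy lin[OF x] lin[OF y] sym[OF y x] by (simp add: algebra_simps)
  \<comment> \<open>One of \<open>x\<close> and \<open>y\<close> may be zero; this weak form covers
    that case.\<close>
  have le: "t \<bullet> (P *\<^sub>v (G *\<^sub>v t)) \<le> 0" if "t \<in> carrier_vec n" for t
    using neg[OF that] P G by (cases "t = 0\<^sub>v n") (auto simp: less_imp_le)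
  have "x \<noteq> 0\<^sub>v n \<or> y \<noteq> 0\<^sub>v n"
  proof (rule ccontr)
    assume "\<not> ?thesis"
    then have "v $ i = 0" if "i < n" for i
      using that v(1) by (auto simp: x_def y_def vec_eq_iff complex_eq_iff)
    then show False using v by (auto simp: vec_eq_iff)
  qed
  then have "x \<bullet> (P *\<^sub>v (G *\<^sub>v x)) + y \<bullet> (P *\<^sub>v (G *\<^sub>v y)) < 0"
    using neg[OF x] neg[OF y] le[OF x] le[OF y] by (meson add_neg_nonpos add_nonpos_neg)
  then have "Re z * (x \<bullet> (P *\<^sub>v x) + y \<bullet> (P *\<^sub>v y)) < 0" unfolding eq .
  moreover have "0 \<le> x \<bullet> (P *\<^sub>v x) + y \<bullet> (P *\<^sub>v y)" using nonneg x y by simp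
  ultimately show "Re z < 0" by (simp add: mult_less_0_iff)
qed

section \<open>A dissipation inequality from stabilizability\<close>

text \<open>The stabilizing \<open>K\<close> disappears from the conclusion: only a bound on its
  size survives, inside \<open>C\<close>. This frees the later feedback gain from the choice of
  \<open>K\<close>.\<close>

lemma stabilizable_quadratic_form:
  assumes A: "A \<in> carrier_mat n n" and B: "B \<in> carrier_mat n m" and st: "stabilizable A B"
  shows "\<exists>P \<in> carrier_mat n n. \<exists>\<beta>>0. \<exists>C>0.
    (\<forall>x \<in> carrier_vec n. \<forall>y \<in> carrier_vec n. x \<bullet> (P *\<^sub>v y) = y \<bullet> (P *\<^sub>v x)) \<and>
    (\<forall>x \<in> carrier_vec n. 0 \<le> x \<bullet> (P *\<^sub>v x)) \<and>
    (\<forall>x \<in> carrier_vec n. x \<bullet> (P *\<^sub>v (A *\<^sub>v x))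
      \<le> C * ((B\<^sup>T *\<^sub>v (P *\<^sub>v x)) \<bullet> (B\<^sup>T *\<^sub>v (P *\<^sub>v x))) - \<beta> * (x \<bullet> x))"
proof -
  obtain K where K: "K \<in> carrier_mat m n" and hK: "hurwitz (A - B * K)"
    using st A B by (auto simp: stabilizable_def)
  have BK: "B * K \<in> carrier_mat n n" using B K by simp
  have H: "A - B * K \<in> carrier_mat n n" by (rule minus_carrier_mat[OF BK])
  obtain P \<beta> where P: "P \<in> carrier_mat n n" and \<beta>: "0 < \<beta>"
    and sym: "\<And>x y. x \<in> carrier_vec n \<Longrightarrow> y \<in> carrier_vec n \<Longrightarrow> x \<bullet> (P *\<^sub>v y) = y \<bullet> (P *\<^sub>v x)"
    and nonneg: "\<And>x. x \<in> carrier_vec n \<Longrightarrow> 0 \<le> x \<bullet> (P *\<^sub>v x)"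
    and lyap: "\<And>x. x \<in> carrier_vec n \<Longrightarrow> x \<bullet> (P *\<^sub>v ((A - B * K) *\<^sub>v x)) \<le> - \<beta> * (x \<bullet> x)"
    using hurwitz_lyapunov[OF H hK] by blast
  obtain k where k: "0 < k" and kb: "\<And>x. x \<in> carrier_vec n \<Longrightarrow>
      (\<Sum>i=0..<m. (norm ((K *\<^sub>v x) $ i))\<^sup>2) \<le> k * (\<Sum>j=0..<n. (norm (x $ j))\<^sup>2)"
    using mult_mat_vec_bound[OF K] by blast
  have "x \<bullet> (P *\<^sub>v (A *\<^sub>v x))
      \<le> k / (2 * \<beta>) * ((B\<^sup>T *\<^sub>v (P *\<^sub>v x)) \<bullet> (B\<^sup>T *\<^sub>v (P *\<^sub>v x))) - \<beta> / 2 * (x \<bullet> x)"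
    if x: "x \<in> carrier_vec n" for x
  proof -
    define g where "g = B\<^sup>T *\<^sub>v (P *\<^sub>v x)"
    define h where "h = K *\<^sub>v x"
    have g: "g \<in> carrier_vec m" and h: "h \<in> carrier_vec m" and Px: "P *\<^sub>v x \<in> carrier_vec n"
      and Ax: "A *\<^sub>v x \<in> carrier_vec n" and Bh: "B *\<^sub>v h \<in> carrier_vec n"
      using A B K P x by (auto simp: g_def h_def)
    have "(A - B * K) *\<^sub>v x = A *\<^sub>v x - B *\<^sub>v h"
      unfolding h_def using minus_mult_distrib_mat_vec[OF A BK x] assoc_mult_mat_vec[OF B K x] by simp
    then have "x \<bullet> (P *\<^sub>v ((A - B * K) *\<^sub>v x)) = x \<bullet> (P *\<^sub>v (A *\<^sub>v x)) - x \<bullet> (P *\<^sub>v (B *\<^sub>v h))"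
      using mult_minus_distrib_mat_vec[OF P Ax Bh] scalar_prod_minus_distrib[OF x, of "P *\<^sub>v (A *\<^sub>v x)" "P *\<^sub>v (B *\<^sub>v h)"] P A B Ax Bh
      by simp
    \<comment> \<open>Symmetry of \<open>P\<close> and transposition of \<open>B\<close> move
      everything except \<open>h\<close> to the left factor.\<close>
    moreover have "x \<bullet> (P *\<^sub>v (B *\<^sub>v h)) = g \<bullet> h"
    proof -
      have "x \<bullet> (P *\<^sub>v (B *\<^sub>v h)) = (B *\<^sub>v h) \<bullet> (P *\<^sub>v x)" by (rule sym[OF x Bh])
      also have "\<dots> = (P *\<^sub>v x) \<bullet> (B *\<^sub>v h)" by (rule comm_scalar_prod[OF Bh Px])
      also have "\<dots> = g \<bullet> h" unfolding g_def by (rule transpose_vec_mult_scalar[OF B h Px, symmetric])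
      finally show ?thesis .
    qed
    \<comment> \<open>The parameter \<open>\<beta> / k\<close> is matched to
      \<open>h \<bullet> h \<le> k * (x \<bullet> x)\<close>: the term in \<open>h\<close> then
      costs at most half of the decay \<open>\<beta>\<close>.\<close>
    moreover have "g \<bullet> h \<le> (g \<bullet> g) / (2 * (\<beta> / k)) + \<beta> / k / 2 * (h \<bullet> h)"
      using \<beta> k by (intro scalar_prod_le[OF g h]) simp
    moreover have "\<beta> / k / 2 * (h \<bullet> h) \<le> \<beta> / 2 * (x \<bullet> x)"
    proof -
      have "h \<bullet> h \<le> k * (x \<bullet> x)"
        using kb[OF x, folded h_def] x h by (simp add: scalar_prod_def power2_eq_square)
      then have "\<beta> / k / 2 * (h \<bullet> h) \<le> \<beta> / k / 2 * (k * (x \<bullet> x))"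
        using \<beta> k by (intro mult_left_mono) auto
      then show ?thesis using k by simp
    qed
    moreover have "(g \<bullet> g) / (2 * (\<beta> / k)) = k / (2 * \<beta>) * (g \<bullet> g)" by simp
    moreover have "- \<beta> * (x \<bullet> x) + \<beta> / 2 * (x \<bullet> x) = - (\<beta> / 2 * (x \<bullet> x))" by simp
    ultimately show ?thesis using lyap[OF x] unfolding g_def[symmetric] by linarith
  qed
  moreover have "0 < \<beta> / 2" "0 < k / (2 * \<beta>)" using \<beta> k by auto
  ultimately show ?thesis using P sym nonneg by blast
qed

section \<open>Diagonal dominance of the coupling\<close>

text \<open>Replacing each \<open>g i \<bullet> g j\<close> by the mean of
  \<open>g i \<bullet> g i\<close> and \<open>g j \<bullet> g j\<close> can only lower the sum,
  because off-diagonal weights are nonpositive and diagonal terms do not change. Afterwards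
  \<open>g i \<bullet> g i\<close> has half the sum of row and column \<open>i\<close> as its
  coefficient, which is at least \<open>c\<close>.\<close>

lemma diagonally_dominant_form:
  fixes M :: "real mat" and g :: "nat \<Rightarrow> real vec"
  assumes off: "\<And>i j. i < N \<Longrightarrow> j < N \<Longrightarrow> i \<noteq> j \<Longrightarrow> M $$ (i, j) \<le> 0"
    and dom: "\<And>i. i < N \<Longrightarrow> c \<le> (\<Sum>j=0..<N. M $$ (i, j) + M $$ (j, i)) / 2"
    and g: "\<And>i. i < N \<Longrightarrow> g i \<in> carrier_vec m"
  shows "c * (\<Sum>i=0..<N. g i \<bullet> g i) \<le> (\<Sum>i=0..<N. \<Sum>j=0..<N. M $$ (i, j) * (g i \<bullet> g j))"
proof -
  have "c * (\<Sum>i=0..<N. g i \<bullet> g i) = (\<Sum>i=0..<N. c * (g i \<bullet> g i))" by (rule sum_distrib_left)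
  also have "\<dots> \<le> (\<Sum>i=0..<N. (\<Sum>j=0..<N. M $$ (i, j) + M $$ (j, i)) / 2 * (g i \<bullet> g i))"
    using dom by (intro sum_mono mult_right_mono scalar_prod_self_nonneg) auto
  also have "\<dots> = (\<Sum>i=0..<N. \<Sum>j=0..<N. M $$ (i, j) / 2 * (g i \<bullet> g i))
      + (\<Sum>i=0..<N. \<Sum>j=0..<N. M $$ (j, i) / 2 * (g i \<bullet> g i))"
    by (simp only: sum_divide_distrib sum_distrib_right sum.distrib add_divide_distrib distrib_right)
  \<comment> \<open>Swapping the summation indices rewrites the column sums with weights
    \<open>M $$ (i, j)\<close>, so both parts merge into one double sum.\<close>
  also have "(\<Sum>i=0..<N. \<Sum>j=0..<N. M $$ (j, i) / 2 * (g i \<bullet> g i))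
      = (\<Sum>i=0..<N. \<Sum>j=0..<N. M $$ (i, j) / 2 * (g j \<bullet> g j))"
    by (rule sum.swap)
  also have "(\<Sum>i=0..<N. \<Sum>j=0..<N. M $$ (i, j) / 2 * (g i \<bullet> g i)) + \<dots>
      = (\<Sum>i=0..<N. \<Sum>j=0..<N. M $$ (i, j) * ((g i \<bullet> g i) / 2 + (g j \<bullet> g j) / 2))"
    by (simp only: distrib_left sum.distrib times_divide_eq_right times_divide_eq_left)
  also have "\<dots> \<le> (\<Sum>i=0..<N. \<Sum>j=0..<N. M $$ (i, j) * (g i \<bullet> g j))"
  proof (intro sum_mono)
    fix i j assume "i \<in> {0..<N}" "j \<in> {0..<N}"
    then have ij: "i < N" "j < N" by auto
    show "M $$ (i, j) * ((g i \<bullet> g i) / 2 + (g j \<bullet> g j) / 2) \<le> M $$ (i, j) * (g i \<bullet> g j)"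
    proof (cases "i = j")
      case False
      have "g i \<bullet> g j \<le> (g i \<bullet> g i) / 2 + (g j \<bullet> g j) / 2"
        using scalar_prod_le[OF g[OF ij(1)] g[OF ij(2)], of 1] by simp
      then show ?thesis using off[OF ij False] by (intro mult_left_mono_neg)
    qed simp
  qed
  finally show ?thesis .
qed

section \<open>Feedback gain and stability of the closed loop\<close>

theorem theorem1:
  fixes n m N :: nat and A B Adj D M :: "real mat" and d :: "nat \<Rightarrow> real"
  assumes "A \<in> carrier_mat n n" and "B \<in> carrier_mat n m"
    and "stabilizable A B"
    and "Adj \<in> carrier_mat N N"
    and "\<And>i j. i < N \<Longrightarrow> j < N \<Longrightarrow> Adj $$ (i, j) \<ge> 0"
    and "\<And>i. i < N \<Longrightarrow> Adj $$ (i, i) = 0"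
    and "\<And>i. i < N \<Longrightarrow> d i > 0"
    and "D = mat_diag N d"
    and "M = D - Adj"
    and "\<And>i. i < N \<Longrightarrow> d i > (\<Sum>j<N. Adj $$ (i, j) + Adj $$ (j, i)) / 2"
  shows "\<exists>F \<in> carrier_mat m n.
    stable_system (1\<^sub>m N \<otimes>\<^sub>m A - (1\<^sub>m N \<otimes>\<^sub>m B) * (M \<otimes>\<^sub>m 1\<^sub>m m) * (1\<^sub>m N \<otimes>\<^sub>m F))"
proof -
  note A = assms(1) and B = assms(2) and Adj = assms(4)
  have M: "M \<in> carrier_mat N N" unfolding assms(9) by (rule minus_carrier_mat[OF Adj])
  have M_index: "M $$ (i, j) = (if i = j then d i else 0) - Adj $$ (i, j)" if "i < N" "j < N" for i j
    using that Adj by (simp add: assms(8,9) mat_diag_def)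
  \<comment> \<open>The margin in the degree condition at node \<open>i\<close>. Below,
    \<open>c\<close> is the least margin, capped by 1, which also covers
    \<open>N = 0\<close>.\<close>
  define gap where "gap i = d i - (\<Sum>j<N. Adj $$ (i, j) + Adj $$ (j, i)) / 2" for i
  define c where "c = Min (insert 1 (gap ` {0..<N}))"
  have c: "0 < c" using assms(10) by (auto simp: c_def gap_def)
  have dom: "c \<le> (\<Sum>j=0..<N. M $$ (i, j) + M $$ (j, i)) / 2" if i: "i < N" for i
  proof -
    have "(\<Sum>j=0..<N. M $$ (i, j) + M $$ (j, i))
        = (\<Sum>j=0..<N. (if j = i then 2 * d i else 0) - (Adj $$ (i, j) + Adj $$ (j, i)))"
      using i by (intro sum.cong) (auto simp: M_index)
    also have "\<dots> = 2 * d i - (\<Sum>j=0..<N. Adj $$ (i, j) + Adj $$ (j, i))"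
      using i by (simp only: sum_subtractf) simp
    finally have "(\<Sum>j=0..<N. M $$ (i, j) + M $$ (j, i)) / 2 = gap i"
      by (simp add: gap_def lessThan_atLeast0 diff_divide_distrib)
    moreover have "c \<le> gap i" unfolding c_def using i by (intro Min_le) auto
    ultimately show ?thesis by simp
  qed
  have off: "M $$ (i, j) \<le> 0" if "i < N" "j < N" "i \<noteq> j" for i j
    using that assms(5) by (simp add: M_index)
  obtain P \<beta> C where P: "P \<in> carrier_mat n n" and \<beta>: "0 < \<beta>" and C: "0 < C"
    and sym: "\<And>x y. x \<in> carrier_vec n \<Longrightarrow> y \<in> carrier_vec n \<Longrightarrow> x \<bullet> (P *\<^sub>v y) = y \<bullet> (P *\<^sub>v x)"
    and nonneg: "\<And>x. x \<in> carrier_vec n \<Longrightarrow> 0 \<le> x \<bullet> (P *\<^sub>v x)"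
    and ineq: "\<And>x. x \<in> carrier_vec n \<Longrightarrow> x \<bullet> (P *\<^sub>v (A *\<^sub>v x))
      \<le> C * ((B\<^sup>T *\<^sub>v (P *\<^sub>v x)) \<bullet> (B\<^sup>T *\<^sub>v (P *\<^sub>v x))) - \<beta> * (x \<bullet> x)"
    using stabilizable_quadratic_form[OF A B assms(3)] by blast
  \<comment> \<open>The coupling form is at least \<open>c\<close> times the sum of all
    \<open>g i \<bullet> g i\<close>, so the gain \<open>C / c\<close> yields exactly the amount
    \<open>C\<close> that the dissipation inequality asks for.\<close>
  define F where "F = (C / c) \<cdot>\<^sub>m (B\<^sup>T * P)"
  have BP: "B\<^sup>T * P \<in> carrier_mat m n" and F: "F \<in> carrier_mat m n" using B P by (auto simp: F_def)
  have BF: "B * F \<in> carrier_mat n n" and PA: "P * A \<in> carrier_mat n n" using A B P F by auto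
  have PBF: "P * (B * F) \<in> carrier_mat n n" using P BF by simp
  define G where "G = 1\<^sub>m N \<otimes>\<^sub>m A - (1\<^sub>m N \<otimes>\<^sub>m B) * (M \<otimes>\<^sub>m 1\<^sub>m m) * (1\<^sub>m N \<otimes>\<^sub>m F)"
  have one: "1\<^sub>m N \<in> carrier_mat N N" by simp
  \<comment> \<open>Two uses of the mixed-product rule collapse the triple product, leaving
    \<open>M\<close> to act on the agents and \<open>B * F\<close> on each state.\<close>
  have G_eq: "G = 1\<^sub>m N \<otimes>\<^sub>m A - M \<otimes>\<^sub>m (B * F)"
    unfolding G_def using kron_mult[OF one B M one_carrier_mat] kron_mult[OF M B one F] M B by simp
  have kA: "1\<^sub>m N \<otimes>\<^sub>m A \<in> carrier_mat (N * n) (N * n)" and kBF: "M \<otimes>\<^sub>m (B * F) \<in> carrier_mat (N * n) (N * n)"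
    and kP: "1\<^sub>m N \<otimes>\<^sub>m P \<in> carrier_mat (N * n) (N * n)"
    and kPA: "1\<^sub>m N \<otimes>\<^sub>m (P * A) \<in> carrier_mat (N * n) (N * n)"
    and kPBF: "M \<otimes>\<^sub>m (P * (B * F)) \<in> carrier_mat (N * n) (N * n)"
    using A BF P M PA PBF by auto
  have G: "G \<in> carrier_mat (N * n) (N * n)" unfolding G_eq by (rule minus_carrier_mat[OF kBF])
  \<comment> \<open>With the identity as first factor only equal block indices contribute.\<close>
  have diag: "x \<bullet> ((1\<^sub>m N \<otimes>\<^sub>m L) *\<^sub>v y) = (\<Sum>i=0..<N. vec_block n i x \<bullet> (L *\<^sub>v vec_block n i y))"
    if "L \<in> carrier_mat n n" "x \<in> carrier_vec (N * n)" "y \<in> carrier_vec (N * n)" for L :: "real mat" and x y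
  proof -
    have "(\<Sum>j=0..<N. 1\<^sub>m N $$ (i, j) * q j) = q i" if i: "i < N" for i and q :: "nat \<Rightarrow> real"
    proof -
      have "(\<Sum>j=0..<N. 1\<^sub>m N $$ (i, j) * q j) = (\<Sum>j=0..<N. if j = i then q i else 0)"
        using i by (intro sum.cong) auto
      then show ?thesis using i by simp
    qed
    then show ?thesis unfolding scalar_prod_kron_mult_vec[OF one that] by (intro sum.cong) auto
  qed
  have "hurwitz G"
  proof (rule hurwitzI_quadratic_form[OF G kP])
    fix x y :: "real vec" assume "x \<in> carrier_vec (N * n)" "y \<in> carrier_vec (N * n)"
    then show "x \<bullet> ((1\<^sub>m N \<otimes>\<^sub>m P) *\<^sub>v y) = y \<bullet> ((1\<^sub>m N \<otimes>\<^sub>m P) *\<^sub>v x)"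
      by (auto simp: diag[OF P] intro!: sum.cong sym)
  next
    fix x :: "real vec" assume "x \<in> carrier_vec (N * n)"
    then show "0 \<le> x \<bullet> ((1\<^sub>m N \<otimes>\<^sub>m P) *\<^sub>v x)"
      by (auto simp: diag[OF P] intro!: sum_nonneg nonneg)
  next
    fix x :: "real vec" assume x: "x \<in> carrier_vec (N * n)" and x0: "x \<noteq> 0\<^sub>v (N * n)"
    define b where "b i = vec_block n i x" for i
    define g where "g i = B\<^sup>T *\<^sub>v (P *\<^sub>v b i)" for i
    have b: "b i \<in> carrier_vec n" for i by (simp add: b_def)
    have g: "g i \<in> carrier_vec m" for i using B P b by (simp add: g_def)
    \<comment> \<open>Splits the form into a part internal to each agent and the coupling
      part.\<close>
    have "(1\<^sub>m N \<otimes>\<^sub>m P) * G = 1\<^sub>m N \<otimes>\<^sub>m (P * A) - M \<otimes>\<^sub>m (P * (B * F))"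
      unfolding G_eq using mult_minus_distrib_mat[OF kP kA kBF] kron_mult[OF one P one A] kron_mult[OF one P M BF] M by simp
    then have "x \<bullet> ((1\<^sub>m N \<otimes>\<^sub>m P) *\<^sub>v (G *\<^sub>v x))
        = x \<bullet> ((1\<^sub>m N \<otimes>\<^sub>m (P * A)) *\<^sub>v x - (M \<otimes>\<^sub>m (P * (B * F))) *\<^sub>v x)"
      using assoc_mult_mat_vec[OF kP G x] minus_mult_distrib_mat_vec[OF kPA kPBF x] by simp
    also have "\<dots> = x \<bullet> ((1\<^sub>m N \<otimes>\<^sub>m (P * A)) *\<^sub>v x) - x \<bullet> ((M \<otimes>\<^sub>m (P * (B * F))) *\<^sub>v x)"
      using x kPA kPBF by (intro scalar_prod_minus_distrib[of _ "N * n"] mult_mat_vec_carrier) auto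
    also have "x \<bullet> ((M \<otimes>\<^sub>m (P * (B * F))) *\<^sub>v x)
        = C / c * (\<Sum>i=0..<N. \<Sum>j=0..<N. M $$ (i, j) * (g i \<bullet> g j))"
    proof -
      \<comment> \<open>Because \<open>F\<close> contains the factor \<open>B\<^sup>T * P\<close>,
        each coupling block becomes a multiple of the scalar product of \<open>g i\<close> and
        \<open>g j\<close>.\<close>
      have "b i \<bullet> ((P * (B * F)) *\<^sub>v b j) = C / c * (g i \<bullet> g j)" for i j
      proof -
        have Fb: "F *\<^sub>v b j = (C / c) \<cdot>\<^sub>v g j"
        proof -
          have "F *\<^sub>v b j = (C / c) \<cdot>\<^sub>v ((B\<^sup>T * P) *\<^sub>v b j)"
            unfolding F_def using BP b[of j] by (intro eq_vecI) (auto simp del: index_mult_mat(1))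
          also have "(B\<^sup>T * P) *\<^sub>v b j = g j"
            unfolding g_def using B P b by (intro assoc_mult_mat_vec) auto
          finally show ?thesis .
        qed
        have Pb: "P *\<^sub>v b i \<in> carrier_vec n" and Bg: "B *\<^sub>v g j \<in> carrier_vec n"
          using P B b g by auto
        have "(P * (B * F)) *\<^sub>v b j = P *\<^sub>v (B *\<^sub>v (F *\<^sub>v b j))"
          using assoc_mult_mat_vec[OF P BF b] assoc_mult_mat_vec[OF B F b] by simp
        also have "\<dots> = (C / c) \<cdot>\<^sub>v (P *\<^sub>v (B *\<^sub>v g j))"
          unfolding Fb mult_mat_vec[OF B g] mult_mat_vec[OF P Bg] ..
        finally have "b i \<bullet> ((P * (B * F)) *\<^sub>v b j) = C / c * (b i \<bullet> (P *\<^sub>v (B *\<^sub>v g j)))"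
          using b P Bg by (simp add: scalar_prod_smult_distrib[of _ n])
        also have "b i \<bullet> (P *\<^sub>v (B *\<^sub>v g j)) = (P *\<^sub>v b i) \<bullet> (B *\<^sub>v g j)"
          using sym[OF b Bg] comm_scalar_prod[OF Bg Pb] by simp
        also have "\<dots> = g i \<bullet> g j" unfolding g_def[of i] by (rule transpose_vec_mult_scalar[OF B g Pb, symmetric])
        finally show ?thesis .
      qed
      then show ?thesis
        unfolding scalar_prod_kron_mult_vec[OF M PBF x x] b_def[symmetric]
        by (simp add: sum_distrib_left mult_ac)
    qed
    also have "x \<bullet> ((1\<^sub>m N \<otimes>\<^sub>m (P * A)) *\<^sub>v x) = (\<Sum>i=0..<N. b i \<bullet> (P *\<^sub>v (A *\<^sub>v b i)))"
      unfolding diag[OF PA x x] b_def[symmetric] using assoc_mult_mat_vec[OF P A b] by simp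
    also have "\<dots> \<le> (\<Sum>i=0..<N. C * (g i \<bullet> g i) - \<beta> * (b i \<bullet> b i))"
      unfolding g_def by (intro sum_mono ineq b)
    also have "\<dots> = C / c * (c * (\<Sum>i=0..<N. g i \<bullet> g i)) - \<beta> * (\<Sum>i=0..<N. b i \<bullet> b i)"
      using c by (simp add: sum_subtractf sum_distrib_left)
    \<comment> \<open>Here the coupling outweighs the terms \<open>C * (g i \<bullet> g i)\<close>,
      and only the decay in the states remains.\<close>
    also have "\<dots> - C / c * (\<Sum>i=0..<N. \<Sum>j=0..<N. M $$ (i, j) * (g i \<bullet> g j))
        \<le> - (\<beta> * (\<Sum>i=0..<N. b i \<bullet> b i))"
    proof -
      have "c * (\<Sum>i=0..<N. g i \<bullet> g i) \<le> (\<Sum>i=0..<N. \<Sum>j=0..<N. M $$ (i, j) * (g i \<bullet> g j))"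
        by (rule diagonally_dominant_form[OF off dom g])
      then have "C / c * (c * (\<Sum>i=0..<N. g i \<bullet> g i))
          \<le> C / c * (\<Sum>i=0..<N. \<Sum>j=0..<N. M $$ (i, j) * (g i \<bullet> g j))"
        using c C by (intro mult_left_mono) auto
      then show ?thesis by linarith
    qed
    also have "\<dots> < 0"
    proof -
      \<comment> \<open>A nonzero stacked state has a nonzero block, which makes the inequality
        strict.\<close>
      obtain i where "i < N" "b i \<noteq> 0\<^sub>v n" using vec_block_nonzero[OF x x0] by (auto simp: b_def)
      then have "0 < (\<Sum>i=0..<N. b i \<bullet> b i)"
        using scalar_prod_self_pos[OF b]
        by (intro sum_pos2[of _ i]) (auto simp: scalar_prod_self_nonneg)
      then show ?thesis using \<beta> by simp
    qed
    finally show "x \<bullet> ((1\<^sub>m N \<otimes>\<^sub>m P) *\<^sub>v (G *\<^sub>v x)) < 0" by simp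
  qed
  then show ?thesis using F by (auto simp: stable_system_def G_def)
qed

end
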